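(* Let $A_h$ be the fixed, time-independent $N\times N$ Markov generator associated with the jump rates, so that $(A_h)_{ij}\ge 0$ for $i\ne j$ and $\bm{1}^\top A_h=\bm{0}^\top$. Assume, in addition, that $A_h$ satisfies detailed balance with respect to the discrete Gibbs state $\bm\rho^{\rm eq}$, $\rho_i^{\rm eq}=Z_h^{-1}e^{-V_i}>0$, namely $(A_h)_{ij}\rho_j^{\rm eq}=(A_h)_{ji}\rho_i^{\rm eq}$ for $i\ne j$. Then, for any $\Delta t>0$, the implicit Euler scheme $$\frac{\bm\rho^{n+1}-\bm\rho^n}{\Delta t}=A_h\bm\rho^{n+1},\qquad\text{i.e.}\qquad (I-\Delta t A_h)\bm\rho^{n+1}=\bm\rho^n,$$ satisfies the following properties: (1) (Unconditional positivity preservation) if $\bm\rho^n>0$ componentwise, then $\bm\rho^{n+1}>0$ componentwise; (2) (Mass conservation) $\sum_i\rho_i^{n+1}=\sum_i\rho_i^n$; (3) (Energy stability) for $\bm\rho^n>0$, $\mathcal{F}_h[\bm\rho^{n+1}]\le\mathcal{F}_h[\bm\rho^n]$.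
   Context: $h=1/N$, $V_0,\dots,V_{N-1}\in\mathbb{R}$, $Z_h=h\sum_{j=0}^{N-1}e^{-V_j}$, and the discrete free energy is $\mathcal{F}_h[\bm\rho]=h\sum_{i=0}^{N-1}(\rho_i\ln\rho_i-\rho_i+\rho_iV_i)$. The generator associated with jump rates $F_{i+\frac12},B_{i+\frac12}\ge 0$ (indices periodic modulo $N$) is the matrix defined by $(A_h\bm\rho)_i=B_{i+\frac12}\rho_{i+1}-F_{i+\frac12}\rho_i-B_{i-\frac12}\rho_i+F_{i-\frac12}\rho_{i-1}$; $\bm 1$ is the all-ones vector. *)

theory Defs
  imports Complex_Main "Jordan_Normal_Form.Determinant"
begin

definition mesh :: "nat \<Rightarrow> real" where
  "mesh N = 1 / real N"

definition partition_sum :: "nat \<Rightarrow> (nat \<Rightarrow> real) \<Rightarrow> real" where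
  "partition_sum N V = mesh N * (\<Sum>j<N. exp (- V j))"

definition gibbs_state :: "nat \<Rightarrow> (nat \<Rightarrow> real) \<Rightarrow> real vec" where
  "gibbs_state N V = vec N (\<lambda>i. exp (- V i) / partition_sum N V)"

definition free_energy :: "nat \<Rightarrow> (nat \<Rightarrow> real) \<Rightarrow> real vec \<Rightarrow> real" where
  "free_energy N V \<rho> = mesh N * (\<Sum>i<N. \<rho> $ i * ln (\<rho> $ i) - \<rho> $ i + \<rho> $ i * V i)"

text \<open>Nodes are the residues 0, ..., N - 1 modulo N, and these are the two neighbours of a node.\<close>

definition next_node :: "nat \<Rightarrow> nat \<Rightarrow> nat" where
  "next_node N i = (i + 1) mod N"

definition prev_node :: "nat \<Rightarrow> nat \<Rightarrow> nat" where
  "prev_node N i = (i + N - 1) mod N"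

text \<open>\<open>F i\<close> and \<open>B i\<close> stand for the rates with index i + 1/2, so that index i - 1/2 is
  \<open>prev_node N i\<close>.  The contributions are added up because for N = 1 and N = 2 the nodes
  i - 1, i, i + 1 are not pairwise distinct; \<open>jump_generator_mult_vec\<close> below is the
  formula that defines the generator through its action on vectors.\<close>

definition jump_generator :: "nat \<Rightarrow> (nat \<Rightarrow> real) \<Rightarrow> (nat \<Rightarrow> real) \<Rightarrow> real mat" where
  "jump_generator N F B = mat N N (\<lambda>(i, j).
     B i * of_bool (j = next_node N i)
     - F i * of_bool (j = i)
     - B (prev_node N i) * of_bool (j = i)
     + F (prev_node N i) * of_bool (j = prev_node N i))"

definition markov_generator :: "nat \<Rightarrow> real mat \<Rightarrow> bool" where
  "markov_generator N A \<longleftrightarrow> A \<in> carrier_mat N N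
     \<and> (\<forall>i<N. \<forall>j<N. i \<noteq> j \<longrightarrow> A $$ (i, j) \<ge> 0)
     \<and> (\<forall>j<N. (\<Sum>i<N. A $$ (i, j)) = 0)"

definition detailed_balance :: "nat \<Rightarrow> real mat \<Rightarrow> real vec \<Rightarrow> bool" where
  "detailed_balance N A \<pi> \<longleftrightarrow>
     (\<forall>i<N. \<forall>j<N. i \<noteq> j \<longrightarrow> A $$ (i, j) * \<pi> $ j = A $$ (j, i) * \<pi> $ i)"

definition implicit_euler_step :: "real mat \<Rightarrow> real \<Rightarrow> real vec \<Rightarrow> real vec \<Rightarrow> bool" where
  "implicit_euler_step A dt \<rho> \<rho>' \<longleftrightarrow> (1 / dt) \<cdot>\<^sub>v (\<rho>' - \<rho>) = A *\<^sub>v \<rho>'"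

definition pos_vec :: "nat \<Rightarrow> real vec \<Rightarrow> bool" where
  "pos_vec N \<rho> \<longleftrightarrow> (\<forall>i<N. \<rho> $ i > 0)"

lemma next_node_less: "0 < N \<Longrightarrow> next_node N i < N"
  and prev_node_less: "0 < N \<Longrightarrow> prev_node N i < N"
  by (auto simp: next_node_def prev_node_def)

lemma next_prev_node: "i < N \<Longrightarrow> next_node N (prev_node N i) = i"
  by (cases "i = 0") (auto simp: next_node_def prev_node_def mod_if)

lemma prev_next_node: "i < N \<Longrightarrow> prev_node N (next_node N i) = i"
  by (auto simp: next_node_def prev_node_def mod_if)

lemma jump_generator_carrier [simp]: "jump_generator N F B \<in> carrier_mat N N"
  by (simp add: jump_generator_def)

lemma jump_generator_mult_vec:
  assumes "\<rho> \<in> carrier_vec N" "i < N"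
  shows "(jump_generator N F B *\<^sub>v \<rho>) $ i =
    B i * \<rho> $ next_node N i - F i * \<rho> $ i
    - B (prev_node N i) * \<rho> $ i + F (prev_node N i) * \<rho> $ prev_node N i"
proof -
  have pt: "(\<Sum>j\<in>{0..<N}. c * of_bool (j = k) * \<rho> $ j) = c * \<rho> $ k" if "k < N" for c k
    using that by (simp add: of_bool_def if_distrib if_distribR sum.delta cong: if_cong)
  have k: "next_node N i < N" "prev_node N i < N"
    using assms(2) by (auto intro!: next_node_less prev_node_less)
  have "(jump_generator N F B *\<^sub>v \<rho>) $ i
      = (\<Sum>j\<in>{0..<N}. jump_generator N F B $$ (i, j) * \<rho> $ j)"
    using assms by (simp add: jump_generator_def scalar_prod_def)
  also have "\<dots> = (\<Sum>j\<in>{0..<N}.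
     B i * of_bool (j = next_node N i) * \<rho> $ j
     - F i * of_bool (j = i) * \<rho> $ j
     - B (prev_node N i) * of_bool (j = i) * \<rho> $ j
     + F (prev_node N i) * of_bool (j = prev_node N i) * \<rho> $ j)"
    using assms by (intro sum.cong) (auto simp: jump_generator_def algebra_simps)
  also have "\<dots> = B i * \<rho> $ next_node N i - F i * \<rho> $ i
    - B (prev_node N i) * \<rho> $ i + F (prev_node N i) * \<rho> $ prev_node N i"
    unfolding sum.distrib sum_subtractf by (simp only: pt k assms(2))
  finally show ?thesis .
qed

lemma markov_generator_jump_generator:
  assumes "\<And>i. i < N \<Longrightarrow> F i \<ge> 0" "\<And>i. i < N \<Longrightarrow> B i \<ge> 0"
  shows "markov_generator N (jump_generator N F B)"
  unfolding markov_generator_def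
proof (intro conjI allI impI)
  fix i j assume ij: "i < N" "j < N" "i \<noteq> j"
  then have "prev_node N i < N" by (auto intro!: prev_node_less)
  with ij assms show "jump_generator N F B $$ (i, j) \<ge> 0"
    by (auto simp: jump_generator_def intro!: add_nonneg_nonneg mult_nonneg_nonneg)
next
  fix j assume j: "j < N"
  then have k: "next_node N j < N" "prev_node N j < N"
    by (auto intro!: next_node_less prev_node_less)
  have nx: "j = next_node N i \<longleftrightarrow> i = prev_node N j" if "i < N" for i
    using that j next_prev_node prev_next_node by metis
  have pv: "j = prev_node N i \<longleftrightarrow> i = next_node N j" if "i < N" for i
    using that j next_prev_node prev_next_node by metis
  have pt: "(\<Sum>i<N. c i * of_bool (i = k)) = c k" if "k < N" for k and c :: "nat \<Rightarrow> real"
    using that by (simp add: of_bool_def if_distrib if_distribR sum.delta cong: if_cong)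
  have "(\<Sum>i<N. jump_generator N F B $$ (i, j)) = (\<Sum>i<N.
     B i * of_bool (i = prev_node N j)
     - F i * of_bool (i = j)
     - B (prev_node N i) * of_bool (i = j)
     + F (prev_node N i) * of_bool (i = next_node N j))"
    using j by (intro sum.cong) (auto simp: jump_generator_def nx pv)
  also have "\<dots> = 0"
    unfolding sum.distrib sum_subtractf
    by (simp add: pt k j prev_next_node)
  finally show "(\<Sum>i<N. jump_generator N F B $$ (i, j)) = 0" .
qed simp

lemma implicit_euler_step_iff:
  assumes "A \<in> carrier_mat N N" "\<rho> \<in> carrier_vec N" "\<rho>' \<in> carrier_vec N" "dt > 0"
  shows "implicit_euler_step A dt \<rho> \<rho>' \<longleftrightarrow> (1\<^sub>m N - dt \<cdot>\<^sub>m A) *\<^sub>v \<rho>' = \<rho>"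
proof -
  have e: "((1\<^sub>m N - dt \<cdot>\<^sub>m A) *\<^sub>v \<rho>') $ i = \<rho>' $ i - dt * (A *\<^sub>v \<rho>') $ i" if "i < N" for i
  proof -
    have "(1\<^sub>m N - dt \<cdot>\<^sub>m A) *\<^sub>v \<rho>' = 1\<^sub>m N *\<^sub>v \<rho>' - (dt \<cdot>\<^sub>m A) *\<^sub>v \<rho>'"
      using assms by (intro minus_mult_distrib_mat_vec) auto
    then show ?thesis using assms that by (simp add: scalar_prod_def sum_distrib_left mult_ac)
  qed
  have l: "implicit_euler_step A dt \<rho> \<rho>' \<longleftrightarrow>
      (\<forall>i<N. (1 / dt) * (\<rho>' $ i - \<rho> $ i) = (A *\<^sub>v \<rho>') $ i)"
    using assms unfolding implicit_euler_step_def by (auto simp: vec_eq_iff)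
  have r: "(1\<^sub>m N - dt \<cdot>\<^sub>m A) *\<^sub>v \<rho>' = \<rho> \<longleftrightarrow>
      (\<forall>i<N. ((1\<^sub>m N - dt \<cdot>\<^sub>m A) *\<^sub>v \<rho>') $ i = \<rho> $ i)"
    using assms by (auto simp: vec_eq_iff simp del: index_mult_mat_vec)
  have pw: "(1 / dt) * (x - y) = z \<longleftrightarrow> x - dt * z = y" for x y z
    using assms(4) by (auto simp: field_simps)
  show ?thesis unfolding l r pw using e by auto
qed

text \<open>The scheme is well posed: the columns of I - dt A are strictly diagonally dominant.\<close>

lemma implicit_euler_step_unique_solution:
  assumes A: "markov_generator N A" and \<rho>: "\<rho> \<in> carrier_vec N" and dt: "dt > 0"
  shows "\<exists>!\<rho>'. \<rho>' \<in> carrier_vec N \<and> implicit_euler_step A dt \<rho> \<rho>'"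
proof -
  define M where "M = 1\<^sub>m N - dt \<cdot>\<^sub>m A"
  have Ac: "A \<in> carrier_mat N N" and off: "\<And>i j. i < N \<Longrightarrow> j < N \<Longrightarrow> i \<noteq> j \<Longrightarrow> A $$ (i, j) \<ge> 0"
    and col: "\<And>j. j < N \<Longrightarrow> (\<Sum>i<N. A $$ (i, j)) = 0"
    using A by (auto simp: markov_generator_def)
  have Mc: "M \<in> carrier_mat N N" using Ac by (simp add: M_def minus_carrier_mat)
  have ker: "v = 0\<^sub>v N" if v: "v \<in> carrier_vec N" and Mv: "M *\<^sub>v v = 0\<^sub>v N" for v
  proof -
    have "implicit_euler_step A dt (0\<^sub>v N) v"
      using Mv implicit_euler_step_iff[OF Ac _ v dt] by (simp add: M_def)
    then have st: "(1 / dt) \<cdot>\<^sub>v (v - 0\<^sub>v N) = A *\<^sub>v v"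
      by (simp add: implicit_euler_step_def)
    have vi: "v $ i = dt * (\<Sum>j<N. A $$ (i, j) * v $ j)" if i: "i < N" for i
    proof -
      have "((1 / dt) \<cdot>\<^sub>v (v - 0\<^sub>v N)) $ i = (A *\<^sub>v v) $ i" using st by simp
      then have "(1 / dt) * v $ i = (\<Sum>j<N. A $$ (i, j) * v $ j)"
        using i v Ac by (simp add: scalar_prod_def atLeast0LessThan)
      then show ?thesis using dt by (simp add: field_simps)
    qed
    have "\<bar>v $ i\<bar> \<le> dt * (\<Sum>j<N. A $$ (i, j) * \<bar>v $ j\<bar>)" if i: "i < N" for i
    proof -
      have "\<bar>v $ i\<bar> = sgn (v $ i) * v $ i" by (simp add: abs_sgn mult.commute)
      also have "\<dots> = dt * (\<Sum>j<N. A $$ (i, j) * (sgn (v $ i) * v $ j))"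
        by (subst (2) vi[OF i]) (simp add: sum_distrib_left mult_ac)
      also have "\<dots> \<le> dt * (\<Sum>j<N. A $$ (i, j) * \<bar>v $ j\<bar>)"
      proof (rule mult_left_mono[OF sum_mono])
        fix j assume "j \<in> {..<N}"
        then have j: "j < N" by simp
        have le: "sgn (v $ i) * v $ j \<le> \<bar>v $ j\<bar>"
          by (auto simp: sgn_if)
        show "A $$ (i, j) * (sgn (v $ i) * v $ j) \<le> A $$ (i, j) * \<bar>v $ j\<bar>"
        proof (cases "i = j")
          case True then show ?thesis by (auto simp: sgn_if)
        next
          case False then show ?thesis using off[OF i j False] le by (simp add: mult_left_mono)
        qed
      qed (use dt in simp)
      finally show ?thesis .
    qed
    then have "(\<Sum>i<N. \<bar>v $ i\<bar>) \<le> (\<Sum>i<N. dt * (\<Sum>j<N. A $$ (i, j) * \<bar>v $ j\<bar>))"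
      by (intro sum_mono) auto
    also have "\<dots> = dt * (\<Sum>j<N. (\<Sum>i<N. A $$ (i, j)) * \<bar>v $ j\<bar>)"
      unfolding sum_distrib_left[symmetric] sum_distrib_right by (subst sum.swap) simp
    also have "\<dots> = 0" using col by simp
    finally have "(\<Sum>i<N. \<bar>v $ i\<bar>) = 0"
      by (intro antisym sum_nonneg) auto
    then have "\<forall>i<N. v $ i = 0" by (subst (asm) sum_nonneg_eq_0_iff) auto
    then show ?thesis using v by auto
  qed
  then have "det M \<noteq> 0" using det_0_iff_vec_prod_zero_field[OF Mc] by blast
  then obtain M' where M': "M' \<in> carrier_mat N N" "M' * M = 1\<^sub>m N" "M * M' = 1\<^sub>m N"
    using det_non_zero_imp_unit[OF Mc, of "()"]
    by (auto simp: Units_def ring_mat_def)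
  have eq: "implicit_euler_step A dt \<rho> x \<longleftrightarrow> M *\<^sub>v x = \<rho>" if "x \<in> carrier_vec N" for x
    using implicit_euler_step_iff[OF Ac \<rho> that dt] by (simp add: M_def)
  show ?thesis
  proof (rule ex1I[of _ "M' *\<^sub>v \<rho>"])
    show "M' *\<^sub>v \<rho> \<in> carrier_vec N \<and> implicit_euler_step A dt \<rho> (M' *\<^sub>v \<rho>)"
      using M' Mc \<rho> by (simp add: eq flip: assoc_mult_mat_vec[of M N N M' N \<rho>])
  next
    fix x assume x: "x \<in> carrier_vec N \<and> implicit_euler_step A dt \<rho> x"
    then have "M' *\<^sub>v \<rho> = M' *\<^sub>v (M *\<^sub>v x)" using eq by auto
    also have "\<dots> = (M' * M) *\<^sub>v x" using M' Mc x assoc_mult_mat_vec[of M' N N M N x] by auto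
    also have "\<dots> = x" using M' x by simp
    finally show "x = M' *\<^sub>v \<rho>" by simp
  qed
qed

end

theory Submission
  imports Defs
begin

text \<open>Write \<open>y\<close> for the old and \<open>x\<close> for the new vector, so that \<open>x = y + dt A x\<close>.
  Each of the three properties comes from testing this identity with a suitable vector.

  Testing with the indicator of \<open>S = {i. x i \<le> 0}\<close> gives positivity: in net no mass flows out of
  \<open>S\<close>, because the values of \<open>x\<close> on \<open>S\<close> are the nonpositive ones, so
  the sum of \<open>x\<close> over \<open>S\<close> is at least the sum of \<open>y\<close> over \<open>S\<close>. The first
  is at most zero and the second is positive unless \<open>S\<close> is empty
  (\<open>implicit_euler_step_positive\<close>). Testing with the all-ones vector gives mass conservation
  (\<open>implicit_euler_step_mass\<close>).

  For the energy, convexity bounds the increment of the free energy by testing with its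
  gradient at the new state, whose entries are \<open>ln (x i) + V i\<close>
  (\<open>entropy_tangent_inequality\<close>); this is why the implicit scheme is stable for every
  step size. Up to an additive constant, which is invisible by mass conservation, the gradient is
  \<open>ln (x i / \<pi> i)\<close>, where \<open>\<pi>\<close> is the Gibbs state. Detailed balance makes
  \<open>\<pi>\<close> stationary, and relative entropy with respect to a stationary state does not grow
  along the flow of \<open>A\<close> (\<open>relative_entropy_production_nonpos\<close>).\<close>

lemma implicit_euler_step_nth:
  assumes "markov_generator N A" "\<rho> \<in> carrier_vec N" "\<rho>' \<in> carrier_vec N" "dt > 0"
    and "implicit_euler_step A dt \<rho> \<rho>'" "i < N"
  shows "\<rho>' $ i - \<rho> $ i = dt * (\<Sum>j<N. A $$ (i, j) * \<rho>' $ j)"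
proof -
  have Ac: "A \<in> carrier_mat N N" using assms(1) by (simp add: markov_generator_def)
  have "((1 / dt) \<cdot>\<^sub>v (\<rho>' - \<rho>)) $ i = (A *\<^sub>v \<rho>') $ i"
    using assms(5) by (simp add: implicit_euler_step_def)
  then have "(1 / dt) * (\<rho>' $ i - \<rho> $ i) = (\<Sum>j<N. A $$ (i, j) * \<rho>' $ j)"
    using assms Ac by (simp add: scalar_prod_def atLeast0LessThan)
  then show ?thesis using assms(4) by (simp add: field_simps)
qed

lemma implicit_euler_step_mass:
  assumes A: "markov_generator N A" and "\<rho> \<in> carrier_vec N" "\<rho>' \<in> carrier_vec N" "dt > 0"
    and "implicit_euler_step A dt \<rho> \<rho>'"
  shows "(\<Sum>i<N. \<rho>' $ i) = (\<Sum>i<N. \<rho> $ i)"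
proof -
  have "(\<Sum>i<N. \<rho>' $ i - \<rho> $ i) = (\<Sum>i<N. dt * (\<Sum>j<N. A $$ (i, j) * \<rho>' $ j))"
    by (rule sum.cong) (use implicit_euler_step_nth[OF assms] in auto)
  also have "\<dots> = dt * (\<Sum>j<N. (\<Sum>i<N. A $$ (i, j)) * \<rho>' $ j)"
    unfolding sum_distrib_left[symmetric] sum_distrib_right by (subst sum.swap) simp
  also have "\<dots> = 0" using A by (simp add: markov_generator_def)
  finally show ?thesis by (simp add: sum_subtractf)
qed

text \<open>The discrete minimum principle. The nodes with nonpositive value are summed up instead of
  picking a node where the minimum is attained, since it is the columns of the generator, not its
  rows, that sum to zero.\<close>

lemma implicit_euler_step_positive:
  assumes A: "markov_generator N A" and "\<rho> \<in> carrier_vec N" "\<rho>' \<in> carrier_vec N" and dt: "dt > 0"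
    and "implicit_euler_step A dt \<rho> \<rho>'" and pos: "pos_vec N \<rho>"
  shows "pos_vec N \<rho>'"
proof -
  define S where "S = {i. i < N \<and> \<rho>' $ i \<le> 0}"
  have fin: "finite S" and SN: "S \<subseteq> {..<N}" by (auto simp: S_def)
  have off: "A $$ (i, j) \<ge> 0" if "i < N" "j < N" "i \<noteq> j" for i j
    using A that by (auto simp: markov_generator_def)
  have flux: "(\<Sum>i\<in>S. A $$ (i, j)) * \<rho>' $ j \<ge> 0" if j: "j < N" for j
  proof (cases "j \<in> S")
    case True
    have "(\<Sum>i\<in>S. A $$ (i, j)) + (\<Sum>i\<in>{..<N} - S. A $$ (i, j)) = (\<Sum>i<N. A $$ (i, j))"
      using SN by (simp add: sum.subset_diff add.commute)
    moreover have "(\<Sum>i\<in>{..<N} - S. A $$ (i, j)) \<ge> 0"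
      using True j by (intro sum_nonneg off) auto
    ultimately have "(\<Sum>i\<in>S. A $$ (i, j)) \<le> 0"
      using A j by (simp add: markov_generator_def)
    with True show ?thesis by (simp add: S_def mult_nonpos_nonpos)
  next
    case False
    have "(\<Sum>i\<in>S. A $$ (i, j)) \<ge> 0"
      using False j SN by (intro sum_nonneg off) auto
    with False j show ?thesis by (simp add: S_def)
  qed
  have "(\<Sum>i\<in>S. \<rho>' $ i - \<rho> $ i) = (\<Sum>i\<in>S. dt * (\<Sum>j<N. A $$ (i, j) * \<rho>' $ j))"
    by (rule sum.cong) (use implicit_euler_step_nth[OF assms(1-5)] S_def in auto)
  also have "\<dots> = dt * (\<Sum>j<N. (\<Sum>i\<in>S. A $$ (i, j)) * \<rho>' $ j)"
    unfolding sum_distrib_left[symmetric] sum_distrib_right by (subst sum.swap) simp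
  also have "\<dots> \<ge> 0" by (rule mult_nonneg_nonneg[OF less_imp_le[OF dt] sum_nonneg]) (simp add: flux)
  finally have "(\<Sum>i\<in>S. \<rho> $ i) \<le> (\<Sum>i\<in>S. \<rho>' $ i)" by (simp add: sum_subtractf)
  also have "\<dots> \<le> 0" by (rule sum_nonpos) (simp add: S_def)
  finally have "S = {}"
    using sum_pos[OF fin, of "\<lambda>i. \<rho> $ i"] pos by (force simp: pos_vec_def S_def)
  then show ?thesis by (force simp: pos_vec_def S_def)
qed

text \<open>Detailed balance exchanges the indices in every term of the row sum, which turns it into
  a multiple of a column sum of the generator.\<close>

lemma detailed_balance_stationary:
  assumes A: "markov_generator N A" and "detailed_balance N A \<pi>" "i < N"
  shows "(\<Sum>j<N. A $$ (i, j) * \<pi> $ j) = 0"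
proof -
  have "A $$ (i, j) * \<pi> $ j = A $$ (j, i) * \<pi> $ i" if "j < N" for j
    using assms that by (cases "i = j") (auto simp: detailed_balance_def)
  then have "(\<Sum>j<N. A $$ (i, j) * \<pi> $ j) = (\<Sum>j<N. A $$ (j, i)) * \<pi> $ i"
    by (simp add: sum_distrib_right)
  then show ?thesis using A assms(3) by (simp add: markov_generator_def)
qed

text \<open>The left-hand side is the rate of change of the entropy of \<open>x\<close> relative to the
  stationary state \<open>\<pi>\<close> along the flow of the generator. In terms of the density
  \<open>u j = x j / \<pi> j\<close>, the inequality \<open>ln t \<le> t - 1\<close> bounds the contribution
  of a jump from \<open>j\<close> to \<open>i\<close> by \<open>\<pi> j * (u i - u j)\<close>, and these
  linear bounds cancel in total: against \<open>u i\<close> by stationarity, against \<open>u j\<close>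
  by the vanishing column sums.\<close>

lemma relative_entropy_production_nonpos:
  fixes \<pi> x :: "real vec"
  assumes A: "markov_generator N A"
    and st: "\<And>i. i < N \<Longrightarrow> (\<Sum>j<N. A $$ (i, j) * \<pi> $ j) = 0"
    and \<pi>: "pos_vec N \<pi>" and x: "pos_vec N x"
  shows "(\<Sum>i<N. (\<Sum>j<N. A $$ (i, j) * x $ j) * ln (x $ i / \<pi> $ i)) \<le> 0"
proof -
  define u where "u i = x $ i / \<pi> $ i" for i
  have u: "u i > 0" "x $ i = \<pi> $ i * u i" "\<pi> $ i > 0" if "i < N" for i
    using \<pi> x that by (auto simp: u_def pos_vec_def)
  have col: "(\<Sum>i<N. A $$ (i, j)) = 0" if "j < N" for j
    using A that by (simp add: markov_generator_def)
  have col0: "(\<Sum>i<N. \<Sum>j<N. A $$ (i, j) * c j) = 0" for c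
  proof -
    have "(\<Sum>i<N. \<Sum>j<N. A $$ (i, j) * c j) = (\<Sum>j<N. (\<Sum>i<N. A $$ (i, j)) * c j)"
      unfolding sum_distrib_right by (rule sum.swap)
    then show ?thesis by (simp add: col)
  qed
  have jump: "A $$ (i, j) * (x $ j * (ln (u i) - ln (u j)))
      \<le> A $$ (i, j) * (\<pi> $ j * (u i - u j))" if ij: "i < N" "j < N" for i j
  proof (cases "i = j")
    case False
    have "ln (u i) - ln (u j) \<le> u i / u j - 1"
      using u[OF ij(1)] u[OF ij(2)] ln_le_minus_one[of "u i / u j"] by (simp add: ln_div)
    then have "x $ j * (ln (u i) - ln (u j)) \<le> x $ j * (u i / u j - 1)"
      using x ij by (intro mult_left_mono) (auto simp: pos_vec_def less_imp_le)
    also have "\<dots> = \<pi> $ j * (u i - u j)"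
      using u[OF ij(2)] by (simp add: field_simps)
    finally show ?thesis
      using A ij False by (intro mult_left_mono) (auto simp: markov_generator_def)
  qed simp
  have "(\<Sum>i<N. (\<Sum>j<N. A $$ (i, j) * x $ j) * ln (u i))
      = (\<Sum>i<N. \<Sum>j<N. A $$ (i, j) * (x $ j * ln (u i)))"
    by (simp add: sum_distrib_right mult.assoc)
  \<comment> \<open>the column sums allow the gain \<open>ln (u i)\<close> to be replaced by the jump
    \<open>ln (u i) - ln (u j)\<close>\<close>
  also have "\<dots> = (\<Sum>i<N. \<Sum>j<N. A $$ (i, j) * (x $ j * (ln (u i) - ln (u j))))"
    using col0[of "\<lambda>j. x $ j * ln (u j)"]
    by (simp add: right_diff_distrib sum_subtractf)
  also have "\<dots> \<le> (\<Sum>i<N. \<Sum>j<N. A $$ (i, j) * (\<pi> $ j * (u i - u j)))"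
    by (intro sum_mono jump) auto
  also have "\<dots> = (\<Sum>i<N. (\<Sum>j<N. A $$ (i, j) * \<pi> $ j) * u i)"
    using col0[of "\<lambda>j. \<pi> $ j * u j"]
    by (simp add: right_diff_distrib sum_subtractf sum_distrib_right mult.assoc)
  also have "\<dots> = 0" by (simp add: st)
  finally show ?thesis by (simp add: u_def)
qed

lemma entropy_tangent_inequality:
  fixes x y :: real
  assumes "x > 0" "y > 0"
  shows "(x * ln x - x) - (y * ln y - y) \<le> (x - y) * ln x"
proof -
  have "ln x - ln y \<le> x / y - 1"
    using assms ln_le_minus_one[of "x / y"] by (simp add: ln_div)
  then have "y * (ln x - ln y) \<le> y * (x / y - 1)"
    using assms by (intro mult_left_mono) auto
  also have "\<dots> = x - y" using assms by (simp add: field_simps)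
  finally show ?thesis by (simp add: algebra_simps)
qed

lemma partition_sum_pos:
  assumes "N \<ge> 1"
  shows "partition_sum N V > 0"
  unfolding partition_sum_def mesh_def using assms
  by (intro mult_pos_pos sum_pos) (auto simp: lessThan_empty_iff)

lemma implicit_euler_step_energy_stable:
  assumes N: "N \<ge> 1" and A: "markov_generator N A"
    and db: "detailed_balance N A (gibbs_state N V)"
    and \<rho>: "\<rho> \<in> carrier_vec N" "\<rho>' \<in> carrier_vec N" and dt: "dt > 0"
    and step: "implicit_euler_step A dt \<rho> \<rho>'" and pos: "pos_vec N \<rho>"
  shows "free_energy N V \<rho>' \<le> free_energy N V \<rho>"
proof -
  define Z where "Z = partition_sum N V"
  let ?\<pi> = "gibbs_state N V"
  have Z: "Z > 0" using N partition_sum_pos by (simp add: Z_def)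
  have pos': "pos_vec N \<rho>'" by (rule implicit_euler_step_positive[OF A \<rho> dt step pos])
  have \<pi>: "pos_vec N ?\<pi>" using Z by (simp add: pos_vec_def gibbs_state_def Z_def)
  have grad: "ln (\<rho>' $ i) + V i = ln (\<rho>' $ i / ?\<pi> $ i) - ln Z" if "i < N" for i
  proof -
    have "\<rho>' $ i > 0" using pos' that by (simp add: pos_vec_def)
    then show ?thesis
      using that Z by (simp add: gibbs_state_def Z_def[symmetric] ln_div ln_mult)
  qed
  have mass: "(\<Sum>i<N. \<rho>' $ i - \<rho> $ i) = 0"
    using implicit_euler_step_mass[OF A \<rho> dt step] by (simp add: sum_subtractf)
  have "(\<Sum>i<N. \<rho>' $ i * ln (\<rho>' $ i) - \<rho>' $ i + \<rho>' $ i * V i)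
      - (\<Sum>i<N. \<rho> $ i * ln (\<rho> $ i) - \<rho> $ i + \<rho> $ i * V i)
      = (\<Sum>i<N. (\<rho>' $ i * ln (\<rho>' $ i) - \<rho>' $ i) - (\<rho> $ i * ln (\<rho> $ i) - \<rho> $ i)
          + (\<rho>' $ i - \<rho> $ i) * V i)"
    unfolding sum_subtractf[symmetric] by (rule sum.cong) (auto simp: algebra_simps)
  also have "\<dots> \<le> (\<Sum>i<N. (\<rho>' $ i - \<rho> $ i) * (ln (\<rho>' $ i) + V i))"
    unfolding distrib_left
    by (intro sum_mono add_right_mono entropy_tangent_inequality)
       (use pos pos' in \<open>auto simp: pos_vec_def\<close>)
  also have "\<dots> = (\<Sum>i<N. (\<rho>' $ i - \<rho> $ i) * ln (\<rho>' $ i / ?\<pi> $ i))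
      - (\<Sum>i<N. \<rho>' $ i - \<rho> $ i) * ln Z"
    unfolding sum_distrib_right sum_subtractf[symmetric]
    by (rule sum.cong) (simp_all add: grad right_diff_distrib)
  also have "\<dots> = (\<Sum>i<N. (\<rho>' $ i - \<rho> $ i) * ln (\<rho>' $ i / ?\<pi> $ i))"
    by (simp only: mass)
  also have "\<dots> = dt * (\<Sum>i<N. (\<Sum>j<N. A $$ (i, j) * \<rho>' $ j) * ln (\<rho>' $ i / ?\<pi> $ i))"
    unfolding sum_distrib_left
    by (rule sum.cong)
       (simp_all add: implicit_euler_step_nth[OF A \<rho> dt step] mult.assoc
         flip: sum_distrib_left)
  also have "\<dots> \<le> 0"
    using relative_entropy_production_nonpos[OF A detailed_balance_stationary[OF A db] \<pi> pos'] dt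
    by (simp add: mult_nonneg_nonpos)
  finally show ?thesis
    by (simp add: free_energy_def mesh_def divide_right_mono)
qed

theorem proposition4p1:
  fixes N :: nat
    and V F B :: "nat \<Rightarrow> real"
    and dt :: real
    and \<rho> \<rho>' :: "real vec"
  assumes "N \<ge> 1"
    and "\<And>i. i < N \<Longrightarrow> F i \<ge> 0"
    and "\<And>i. i < N \<Longrightarrow> B i \<ge> 0"
    and "detailed_balance N (jump_generator N F B) (gibbs_state N V)"
    and "dt > 0"
    and "\<rho> \<in> carrier_vec N"
    and "\<rho>' \<in> carrier_vec N"
    and "implicit_euler_step (jump_generator N F B) dt \<rho> \<rho>'"
  shows "(pos_vec N \<rho> \<longrightarrow> pos_vec N \<rho>')
    \<and> (\<Sum>i<N. \<rho>' $ i) = (\<Sum>i<N. \<rho> $ i)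
    \<and> (pos_vec N \<rho> \<longrightarrow> free_energy N V \<rho>' \<le> free_energy N V \<rho>)"
proof -
  have A: "markov_generator N (jump_generator N F B)"
    using assms(2,3) by (rule markov_generator_jump_generator)
  show ?thesis
    using implicit_euler_step_positive[OF A assms(6,7,5,8)]
      implicit_euler_step_mass[OF A assms(6,7,5,8)]
      implicit_euler_step_energy_stable[OF assms(1) A assms(4,6,7,5,8)]
    by blast
qed

end
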